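(* Let $\mathcal G=(\mathcal N,\mathcal L,\mathbf c)$ be a network and let $(\mathbf x^*,\mathbf r^* )$ be the optimal solution given by the DTBP (back-pressure) policy, with corresponding average queue-lengths $\bar P_i^{*d}$. Assume that for all $(i,j)\in\mathcal L$ and $d\in\mathcal D$, $$r_{ij}^{*d}>r_{ji}^{*d}\ \Longrightarrow\ \bar P_i^{*d}>\bar P_j^{*d}.$$ For each $d\in\mathcal D$ define the subgraph $\hat{\mathcal G}^d=(\hat{\mathcal N}^d,\hat{\mathcal L}^d,\hat{\mathbf c}^d)$ by $\hat{\mathcal N}^d=\mathcal N$, $\hat{\mathcal L}^d=\mathcal L\setminus\{\langle i,j\rangle\in\mathcal L:\hat r_{ij}^{*d}=0\}$ (as a set of directed links), and $\hat c_{ij}^d=0$ if $\langle i,j\rangle\notin\hat{\mathcal L}^d$ and $\langle j,i\rangle\notin\hat{\mathcal L}^d$, $\hat c_{ij}^d=c_{ij}$ otherwise, where $\hat r_{ij}^{*d}=(r_{ij}^{*d}-r_{ji}^{*d})^+$. Then $\hat{\mathcal G}^d$ is loop-free (contains no directed cycle) for every $d\in\mathcal D$.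
   Context: **Network.** $\mathcal N$ is a finite set of nodes, $\mathcal L$ a set of bidirectional links $(i,j)$, $c_{ij}=c_{ji}$ the capacity of $(i,j)$ shared by both directions, $\langle i,j\rangle$ the directed link from $i$ to $j$. $\mathcal D\subseteq\mathcal N$ is the set of destinations; commodities are identified with destinations. A strictly concave, twice differentiable, increasing utility function $U_{sd}$ is attached to each source-destination pair $(s,d)$. $(Z)^+=\max(0,Z)$. **Optimization problem.** Maximize $\sum_{s,d}U_{sd}(x_s^d)$ over $\mathbf x,\mathbf r$ subject to $x_s^d\ge0$; $r_{ij}^d\ge0$; $\sum_dr_{ij}^d+\sum_dr_{ji}^d\le c_{ij}$ for $(i,j)\in\mathcal L$; $x_i^d+\sum_{\langle m,i\rangle\in\mathcal L}r_{mi}^d\le\sum_{\langle i,j\rangle\in\mathcal L}r_{ij}^d$ for $i\in\mathcal N$, $d\in\mathcal D$, $i\ne d$. **DTBP policy**, with parameter $K>0$. Each node $i$ keeps a queue $P_i^d[t]$ for each commodity $d$. In slot $t$: the exogenous arrivals $X_s^d[t]$ have conditional mean $\mathbb E(X_s^d[t]\mid P_s^d[t])=\min\{(U_{sd}')^{-1}(P_s^d[t]/K),X_{max}\}$ with $X_{max}$ a finite upper bound for the arrival rate; each link $l=(i,j)$ selects $d_l^*[t]\in\arg\max_d|P_i^d[t]-P_j^d[t]|$ (ties broken uniformly at random) and sets $R_{ij}^d[t]=c_{ij}$ if $d=d_l^*[t]$ and $P_i^d[t]-P_j^d[t]>0$, and $R_{ij}^d[t]=0$ otherwise; queues evolve as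 $P_i^d[t+1]=\big(P_i^d[t]-\sum_{\langle i,j\rangle\in\mathcal L}R_{ij}^d[t]\big)^++X_i^d[t]+\sum_{\langle m,i\rangle\in\mathcal L}R_{mi}^d[t]$. The queue-length Markov chain is positive recurrent and ergodic with steady-state distribution $\pi$. **Solution given by DTBP.** DTBP is assumed to converge to an optimal solution $\{\mathbf X^*[t],\mathbf R^*[t]\}$, and $\mathbf x^*=\lim_{t}\frac1t\sum_{\tau=0}^{t-1}\mathbf X^*[\tau]$, $\mathbf r^*=\lim_t\frac1t\sum_{\tau=0}^{t-1}\mathbf R^*[\tau]$ is called the optimal solution given by back-pressure (the $O(1/K)$ gap to exact optimality is disregarded). The average queue-lengths are $\bar P_i^{*d}=\sum_{\mathbf P}P_i^d\,\pi(\mathbf P)=\lim_t\frac1t\sum_{\tau=0}^t\mathbb E(P_i^d[\tau])$. *)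

theory Defs
  imports "HOL-Probability.Probability"
begin

section \<open>Networks\<close>

text \<open>A link is a directed pair; the links of a bidirectional network form a symmetric relation, and
  a bidirectional link \<open>(i,j)\<close> has the single capacity \<open>cap i j = cap j i\<close>.\<close>

record 'n network =
  nodes :: "'n set"
  links :: "('n \<times> 'n) set"
  cap :: "'n \<Rightarrow> 'n \<Rightarrow> real"

definition loop_free_network :: "'n network \<Rightarrow> bool" where
  "loop_free_network G \<longleftrightarrow> acyclic (links G)"

text \<open>In all families indexed by two nodes and a commodity the order is \<open>r i j d\<close>: rate of
  commodity \<open>d\<close> over the directed link from \<open>i\<close> to \<open>j\<close>. Commodities are destination nodes.\<close>

definition net_rate :: "('n \<Rightarrow> 'n \<Rightarrow> 'n \<Rightarrow> real) \<Rightarrow> 'n \<Rightarrow> 'n \<Rightarrow> 'n \<Rightarrow> real" where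
  "net_rate r i j d = max 0 (r i j d - r j i d)"

definition flow_links :: "'n network \<Rightarrow> ('n \<Rightarrow> 'n \<Rightarrow> 'n \<Rightarrow> real) \<Rightarrow> 'n \<Rightarrow> ('n \<times> 'n) set" where
  "flow_links G r d = links G - {(i, j). (i, j) \<in> links G \<and> net_rate r i j d = 0}"

definition flow_subgraph :: "'n network \<Rightarrow> ('n \<Rightarrow> 'n \<Rightarrow> 'n \<Rightarrow> real) \<Rightarrow> 'n \<Rightarrow> 'n network" where
  "flow_subgraph G r d =
    \<lparr>nodes = nodes G,
     links = flow_links G r d,
     cap = (\<lambda>i j. if (i, j) \<notin> flow_links G r d \<and> (j, i) \<notin> flow_links G r d then 0 else cap G i j)\<rparr>"


section \<open>Utility functions\<close>

definition strictly_concave_on :: "real set \<Rightarrow> (real \<Rightarrow> real) \<Rightarrow> bool" where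
  "strictly_concave_on A u \<longleftrightarrow>
    (\<forall>x\<in>A. \<forall>y\<in>A. \<forall>t. x \<noteq> y \<and> 0 < t \<and> t < 1 \<longrightarrow>
      (1 - t) * u x + t * u y < u ((1 - t) * x + t * y))"

text \<open>Only positive rates are constrained, so that utilities such as \<open>ln\<close>, which tend to \<open>-\<infinity>\<close>
  at \<open>0\<close>, are covered.\<close>

definition utility_function :: "(real \<Rightarrow> real) \<Rightarrow> bool" where
  "utility_function u \<longleftrightarrow>
    strictly_concave_on {0<..} u \<and> strict_mono_on {0<..} u \<and>
    (\<forall>x>0. u differentiable (at x) \<and> deriv u differentiable (at x))"

text \<open>The value at rate \<open>0\<close> is the right limit there, which for an increasing function is the
  infimum over positive rates.\<close>

definition utility_value :: "(real \<Rightarrow> real) \<Rightarrow> real \<Rightarrow> ereal" where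
  "utility_value u x = (if 0 < x then ereal (u x) else (INF y\<in>{0<..}. ereal (u y)))"

text \<open>The inverse of the decreasing function \<open>u'\<close> on positive rates, extended monotonically outside
  the range of \<open>u'\<close>: to \<open>\<infinity>\<close> for prices below all marginal utilities (for instance price \<open>0\<close>), and to
  \<open>0\<close> for prices above all of them.\<close>

definition inverse_marginal :: "(real \<Rightarrow> real) \<Rightarrow> real \<Rightarrow> ereal" where
  "inverse_marginal u y =
    (if y \<in> deriv u ` {0<..} then ereal (the_inv_into {0<..} (deriv u) y)
     else if \<forall>x>0. y < deriv u x then \<infinity> else 0)"


section \<open>The optimization problem\<close>

text \<open>\<open>F\<close> is the set of source-destination pairs \<open>(s,d)\<close>; the other rates \<open>x s d\<close> are \<open>0\<close>.\<close>

locale utility_network =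
  fixes G :: "'n network" and D :: "'n set" and F :: "('n \<times> 'n) set"
    and U :: "'n \<Rightarrow> 'n \<Rightarrow> real \<Rightarrow> real"
  assumes finite_nodes: "finite (nodes G)"
    and links_subset: "links G \<subseteq> nodes G \<times> nodes G"
    and links_sym: "sym (links G)"
    and cap_sym: "\<And>i j. (i, j) \<in> links G \<Longrightarrow> cap G i j = cap G j i"
    and cap_nonneg: "\<And>i j. (i, j) \<in> links G \<Longrightarrow> 0 \<le> cap G i j"
    and destinations: "D \<subseteq> nodes G"
    and pairs: "\<And>s d. (s, d) \<in> F \<Longrightarrow> s \<in> nodes G \<and> d \<in> D \<and> s \<noteq> d"
    and utilities: "\<And>s d. (s, d) \<in> F \<Longrightarrow> utility_function (U s d)"
begin

definition feasible :: "('n \<Rightarrow> 'n \<Rightarrow> real) \<Rightarrow> ('n \<Rightarrow> 'n \<Rightarrow> 'n \<Rightarrow> real) \<Rightarrow> bool" where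
  "feasible x r \<longleftrightarrow>
    (\<forall>s d. (s, d) \<in> F \<longrightarrow> 0 \<le> x s d) \<and>
    (\<forall>s d. (s, d) \<notin> F \<longrightarrow> x s d = 0) \<and>
    (\<forall>i j d. (i, j) \<in> links G \<and> d \<in> D \<longrightarrow> 0 \<le> r i j d) \<and>
    (\<forall>i j. (i, j) \<in> links G \<longrightarrow> (\<Sum>d\<in>D. r i j d) + (\<Sum>d\<in>D. r j i d) \<le> cap G i j) \<and>
    (\<forall>i\<in>nodes G. \<forall>d\<in>D. i \<noteq> d \<longrightarrow>
      x i d + (\<Sum>m | (m, i) \<in> links G. r m i d) \<le> (\<Sum>j | (i, j) \<in> links G. r i j d))"

definition total_utility :: "('n \<Rightarrow> 'n \<Rightarrow> real) \<Rightarrow> ereal" where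
  "total_utility x = (\<Sum>(s, d)\<in>F. utility_value (U s d) (x s d))"

definition optimal_solution :: "('n \<Rightarrow> 'n \<Rightarrow> real) \<Rightarrow> ('n \<Rightarrow> 'n \<Rightarrow> 'n \<Rightarrow> real) \<Rightarrow> bool" where
  "optimal_solution x r \<longleftrightarrow>
    feasible x r \<and> (\<forall>x' r'. feasible x' r' \<longrightarrow> total_utility x' \<le> total_utility x)"

end


section \<open>The DTBP policy\<close>

text \<open>A queue state \<open>p\<close> gives the length \<open>p i d\<close> of the queue of commodity \<open>d\<close> at node \<open>i\<close>; a selection
  \<open>\<sigma>\<close> gives the one commodity \<open>\<sigma> {i,j}\<close> served by the bidirectional link between \<open>i\<close> and \<open>j\<close>.\<close>

definition max_backlog :: "'n set \<Rightarrow> ('n \<Rightarrow> 'n \<Rightarrow> real) \<Rightarrow> 'n \<Rightarrow> 'n \<Rightarrow> 'n set" where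
  "max_backlog D p i j = {d. is_arg_max (\<lambda>d. \<bar>p i d - p j d\<bar>) (\<lambda>d. d \<in> D) d}"

definition link_rate ::
    "'n network \<Rightarrow> ('n \<Rightarrow> 'n \<Rightarrow> real) \<Rightarrow> ('n set \<Rightarrow> 'n) \<Rightarrow> 'n \<Rightarrow> 'n \<Rightarrow> 'n \<Rightarrow> real" where
  "link_rate G p \<sigma> i j d = (if d = \<sigma> {i, j} \<and> 0 < p i d - p j d then cap G i j else 0)"

text \<open>\<open>P t \<omega>\<close>, \<open>X t \<omega>\<close> and \<open>sel t \<omega>\<close> are the queue state, the exogenous arrivals and the selection in
  slot \<open>t\<close>. Traffic leaves the network at its destination, so that the queue of commodity \<open>d\<close> at
  node \<open>d\<close> is always empty; unused coordinates of a queue state are \<open>0\<close> as well. The distribution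
  of \<open>sel\<close> is that of a uniform choice from the maximizers, conditionally on the queue state.\<close>

locale dtbp = utility_network G D F U + prob_space M
  for M :: "'w measure"
    and G :: "'n network" and D :: "'n set" and F :: "('n \<times> 'n) set"
    and U :: "'n \<Rightarrow> 'n \<Rightarrow> real \<Rightarrow> real" +
  fixes K Xmax :: real
    and P X :: "nat \<Rightarrow> 'w \<Rightarrow> 'n \<Rightarrow> 'n \<Rightarrow> real"
    and sel :: "nat \<Rightarrow> 'w \<Rightarrow> 'n set \<Rightarrow> 'n"
  assumes K_pos: "0 < K"
    and P_measurable: "\<And>t i d. random_variable borel (\<lambda>\<omega>. P t \<omega> i d)"
    and X_integrable: "\<And>t s d. integrable M (\<lambda>\<omega>. X t \<omega> s d)"
    and sel_measurable: "\<And>t l. random_variable (count_space UNIV) (\<lambda>\<omega>. sel t \<omega> l)"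
    and P_nonneg: "\<And>t \<omega> i d. \<omega> \<in> space M \<Longrightarrow> 0 \<le> P t \<omega> i d"
    and P_unused: "\<And>t \<omega> i d. \<omega> \<in> space M \<Longrightarrow> i \<notin> nodes G \<or> d \<notin> D \<or> i = d \<Longrightarrow> P t \<omega> i d = 0"
    and X_nonneg: "\<And>t \<omega> s d. \<omega> \<in> space M \<Longrightarrow> 0 \<le> X t \<omega> s d"
    and X_unused: "\<And>t \<omega> s d. \<omega> \<in> space M \<Longrightarrow> (s, d) \<notin> F \<Longrightarrow> X t \<omega> s d = 0"
    and arrivals: "\<And>t s d. (s, d) \<in> F \<Longrightarrow>
      AE \<omega> in M. real_cond_exp M (vimage_algebra (space M) (\<lambda>\<omega>. P t \<omega> s d) borel)
          (\<lambda>\<omega>. X t \<omega> s d) \<omega>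
        = real_of_ereal (min (inverse_marginal (U s d) (P t \<omega> s d / K)) (ereal Xmax))"
    and selection: "\<And>t \<omega> i j. \<omega> \<in> space M \<Longrightarrow> (i, j) \<in> links G \<Longrightarrow>
      sel t \<omega> {i, j} \<in> max_backlog D (P t \<omega>) i j"
    and ties: "\<And>t i j p d. (i, j) \<in> links G \<Longrightarrow> \<P>(\<omega> in M. P t \<omega> = p) > 0 \<Longrightarrow>
      \<P>(\<omega> in M. sel t \<omega> {i, j} = d \<bar> P t \<omega> = p) = pmf (pmf_of_set (max_backlog D p i j)) d"
    and queue_update: "\<And>t \<omega> i d. \<omega> \<in> space M \<Longrightarrow> i \<in> nodes G \<Longrightarrow> d \<in> D \<Longrightarrow> i \<noteq> d \<Longrightarrow>
      P (Suc t) \<omega> i d =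
        max 0 (P t \<omega> i d - (\<Sum>j | (i, j) \<in> links G. link_rate G (P t \<omega>) (sel t \<omega>) i j d))
        + X t \<omega> i d
        + (\<Sum>m | (m, i) \<in> links G. link_rate G (P t \<omega>) (sel t \<omega>) m i d)"
begin

definition converges_to :: "('n \<Rightarrow> 'n \<Rightarrow> real) \<Rightarrow> ('n \<Rightarrow> 'n \<Rightarrow> 'n \<Rightarrow> real) \<Rightarrow> bool" where
  "converges_to x r \<longleftrightarrow>
    (\<forall>s d. AE \<omega> in M. (\<lambda>t. (\<Sum>\<tau><t. X \<tau> \<omega> s d) / real t) \<longlonglongrightarrow> x s d) \<and>
    (\<forall>i j d. (i, j) \<in> links G \<and> d \<in> D \<longrightarrow>
      (AE \<omega> in M. (\<lambda>t. (\<Sum>\<tau><t. link_rate G (P \<tau> \<omega>) (sel \<tau> \<omega>) i j d) / real t) \<longlonglongrightarrow> r i j d))"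

definition backpressure_solution ::
    "('n \<Rightarrow> 'n \<Rightarrow> real) \<Rightarrow> ('n \<Rightarrow> 'n \<Rightarrow> 'n \<Rightarrow> real) \<Rightarrow> bool" where
  "backpressure_solution x r \<longleftrightarrow> converges_to x r \<and> optimal_solution x r"

text \<open>Steady-state means, together with their description as long-run averages.\<close>

definition average_queue_lengths ::
    "('n \<Rightarrow> 'n \<Rightarrow> real) set \<Rightarrow> ('n \<Rightarrow> 'n \<Rightarrow> real) pmf \<Rightarrow> ('n \<Rightarrow> 'n \<Rightarrow> real) \<Rightarrow> bool" where
  "average_queue_lengths S \<pi> Pbar \<longleftrightarrow>
    (\<forall>i\<in>nodes G. \<forall>d\<in>D.
      ((\<lambda>p. p i d * pmf \<pi> p) has_sum Pbar i d) S \<and>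
      (\<forall>t. integrable M (\<lambda>\<omega>. P t \<omega> i d)) \<and>
      (\<lambda>t. (\<Sum>\<tau>\<le>t. expectation (\<lambda>\<omega>. P \<tau> \<omega> i d)) / real t) \<longlonglongrightarrow> Pbar i d)"

end


section \<open>Countable Markov chains\<close>

primrec n_step :: "('s \<Rightarrow> 's pmf) \<Rightarrow> nat \<Rightarrow> 's \<Rightarrow> 's pmf" where
  "n_step \<kappa> 0 x = return_pmf x"
| "n_step \<kappa> (Suc n) x = bind_pmf (\<kappa> x) (n_step \<kappa> n)"

text \<open>\<open>first_passage \<kappa> y n x\<close> is the probability that the chain started in \<open>x\<close> visits \<open>y\<close> at time \<open>n + 1\<close>
  and at no time in \<open>{1..n}\<close>.\<close>

primrec first_passage :: "('s \<Rightarrow> 's pmf) \<Rightarrow> 's \<Rightarrow> nat \<Rightarrow> 's \<Rightarrow> real" where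
  "first_passage \<kappa> y 0 x = pmf (\<kappa> x) y"
| "first_passage \<kappa> y (Suc n) x =
    measure_pmf.expectation (\<kappa> x) (\<lambda>z. if z = y then 0 else first_passage \<kappa> y n z)"

text \<open>Return with probability one, and finite mean return time.\<close>

definition positive_recurrent :: "('s \<Rightarrow> 's pmf) \<Rightarrow> 's \<Rightarrow> bool" where
  "positive_recurrent \<kappa> y \<longleftrightarrow>
    (\<lambda>n. first_passage \<kappa> y n y) sums 1 \<and>
    summable (\<lambda>n. real (Suc n) * first_passage \<kappa> y n y)"

definition ergodic_kernel :: "'s set \<Rightarrow> ('s \<Rightarrow> 's pmf) \<Rightarrow> bool" where
  "ergodic_kernel S \<kappa> \<longleftrightarrow>
    countable S \<and> S \<noteq> {} \<and> (\<forall>x\<in>S. set_pmf (\<kappa> x) \<subseteq> S) \<and>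
    (\<forall>x\<in>S. \<forall>y\<in>S. \<exists>n. 0 < pmf (n_step \<kappa> n x) y) \<and>
    (\<forall>x\<in>S. Gcd {n. 0 < n \<and> 0 < pmf (n_step \<kappa> n x) x} = 1) \<and>
    (\<forall>x\<in>S. positive_recurrent \<kappa> x)"

definition steady_state :: "'s set \<Rightarrow> ('s \<Rightarrow> 's pmf) \<Rightarrow> 's pmf \<Rightarrow> bool" where
  "steady_state S \<kappa> \<pi> \<longleftrightarrow> set_pmf \<pi> \<subseteq> S \<and> bind_pmf \<pi> \<kappa> = \<pi>"

definition markov_chain :: "'w measure \<Rightarrow> 's set \<Rightarrow> ('s \<Rightarrow> 's pmf) \<Rightarrow> (nat \<Rightarrow> 'w \<Rightarrow> 's) \<Rightarrow> bool" where
  "markov_chain M S \<kappa> Z \<longleftrightarrow>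
    (\<forall>t. Z t \<in> M \<rightarrow>\<^sub>M count_space S) \<and>
    (\<forall>t z. \<P>(\<omega> in M. \<forall>\<tau>\<le>Suc t. Z \<tau> \<omega> = z \<tau>)
      = \<P>(\<omega> in M. \<forall>\<tau>\<le>t. Z \<tau> \<omega> = z \<tau>) * pmf (\<kappa> (z t)) (z (Suc t)))"

end

theory Submission
  imports Defs
begin

text \<open>For a fixed commodity the average queue length is a potential on the nodes. A link survives in
  the subgraph exactly when its net rate is positive, and then the hypothesis on the averages says
  that the potential strictly decreases along it; a directed cycle would thus have to end at a
  strictly smaller potential than the one from which it started.\<close>

lemma mem_flow_links:
  "(i, j) \<in> flow_links G r d \<longleftrightarrow> (i, j) \<in> links G \<and> r j i d < r i j d"
  by (auto simp: flow_links_def net_rate_def max_def)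

theorem proposition2:
  fixes M :: "'w measure"
    and G :: "'n network" and D :: "'n set" and F :: "('n \<times> 'n) set"
    and U :: "'n \<Rightarrow> 'n \<Rightarrow> real \<Rightarrow> real"
    and K Xmax :: real
    and P X :: "nat \<Rightarrow> 'w \<Rightarrow> 'n \<Rightarrow> 'n \<Rightarrow> real"
    and sel :: "nat \<Rightarrow> 'w \<Rightarrow> 'n set \<Rightarrow> 'n"
    and S :: "('n \<Rightarrow> 'n \<Rightarrow> real) set"
    and \<kappa> :: "('n \<Rightarrow> 'n \<Rightarrow> real) \<Rightarrow> ('n \<Rightarrow> 'n \<Rightarrow> real) pmf"
    and \<pi> :: "('n \<Rightarrow> 'n \<Rightarrow> real) pmf"
    and x Pbar :: "'n \<Rightarrow> 'n \<Rightarrow> real"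
    and r :: "'n \<Rightarrow> 'n \<Rightarrow> 'n \<Rightarrow> real"
  assumes policy: "dtbp M G D F U K Xmax P X sel"
    and chain: "markov_chain M S \<kappa> P"
    and ergodic: "ergodic_kernel S \<kappa>"
    and steady: "steady_state S \<kappa> \<pi>"
    and solution: "dtbp.backpressure_solution M G D F U P X sel x r"
    and averages: "dtbp.average_queue_lengths M G D P S \<pi> Pbar"
    and downhill: "\<And>i j d. (i, j) \<in> links G \<Longrightarrow> d \<in> D \<Longrightarrow> r i j d > r j i d \<Longrightarrow> Pbar i d > Pbar j d"
  shows "\<forall>d\<in>D. loop_free_network (flow_subgraph G r d)"
proof
  fix d assume "d \<in> D"
  then have "Pbar j d < Pbar i d" if "(i, j) \<in> flow_links G r d" for i j
    using that downhill by (simp add: mem_flow_links)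
  then have "acyclic (flow_links G r d)"
    by (rule acyclicI_order[where f = "\<lambda>i. Pbar i d"])
  then show "loop_free_network (flow_subgraph G r d)"
    by (simp add: loop_free_network_def flow_subgraph_def)
qed

end
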